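(* Fix $\gamma>1$ and consider a (Group II) interaction of an incoming forward wave of strength $f$ (on the left) with a contact of strength $c$ (on the right), of one of the four types: IIa: $f<1$, $c<1$; IIb: $f<1<c$; IIc: $c<1<f$; IId: $f>1$, $c>1$ (with $f,c>0$). Let $B,C,F$ be the strengths of the outgoing backward, contact, and forward waves. Then: (i) In IIa and IIb interactions, $B>1\Leftrightarrow c<1$ and $B<1\Leftrightarrow c>1$. In IIc and IId interactions, $B>1\Leftrightarrow c>1$ and $B<1\Leftrightarrow c<1$. (ii) $F>1\Leftrightarrow f>1$ and $F<1\Leftrightarrow f<1$. (iii) The outgoing contact satisfies: in IIa, $c<C<1$; in IIb, $1<C<c$; in IIc, $C=c<1$; in IId, $C<c$, and $C$ may be either $>1$ or $<1$: more precisely, for each fixed $c>1$ the map $f\mapsto C=C(f,c)$ takes on every value in $(0,c)$ as $f$ increases from $1$ to $\infty$. (iv) A vacuum never forms in IIa, IIb and IId interactions, while in IIc interactions a vacuum occurs if and only if $$f\ \ge\ f^*(c):=\left(\frac{2}{1-\sqrt{c}}\right)^{1/\zeta},\qquad \zeta=\frac{\gamma-1}{2\gamma}.$$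
   Context: Fix the adiabatic constant $\gamma>1$ and set $a=\frac{\gamma-1}{\gamma+1}\in(0,1)$, $\kappa=\sqrt{1-a}$, $\nu=\frac{\sqrt{1-a^2}}{a}$, $\zeta=\frac{a}{1+a}=\frac{\gamma-1}{2\gamma}$. The gas is governed by the 1-d Euler system in Lagrangian coordinates, $\tau_t-u_x=0$, $u_t+p_x=0$, $E_t+(up)_x=0$, $E=\frac{p\tau}{\gamma-1}+\frac{u^2}{2}$; states are $U=(\tau,u,p)\in(0,\infty)\times\mathbb{R}\times(0,\infty)$ (specific volume, velocity, pressure). Define on $(0,\infty)$: $\phi_-(q)=q^{-1/\gamma}$ for $q\le 1$, $\phi_-(q)=\frac{1+aq}{q+a}$ for $q>1$; $\psi_-(q)=\nu(q^\zeta-1)$ for $q\le 1$, $\psi_-(q)=\frac{\kappa(q-1)}{\sqrt{q+a}}$ for $q>1$; $\phi_+(q)=\frac{1+aq}{q+a}$ for $q\le 1$, $\phi_+(q)=q^{-1/\gamma}$ for $q>1$; $\psi_+(q)=\frac{\kappa(q-1)}{\sqrt{q+a}}$ for $q\le1$, $\psi_+(q)=\nu(q^\zeta-1)$ for $q>1$. Wave curves: for a state $\bar U=(\bar\tau,\bar u,\bar p)$ on the left, the state on the right of a single wave is backward wave of strength $b>0$: $W_-(b;\bar U)=(\phi_-(b)\bar\tau,\ \bar u-\psi_-(b)\sqrt{\bar\tau\bar p},\ b\bar p)$ (rarefaction if $b<1$, shock if $b>1$); contact of strength $c>0$: $J(c;\bar U)=(c\bar\tau,\bar u,\bar p)$;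 forward wave of strength $f>0$: $W_+(f;\bar U)=(\phi_+(f)\bar\tau,\ \bar u+\psi_+(f)\sqrt{\bar\tau\bar p},\ f\bar p)$ (shock if $f<1$, rarefaction if $f>1$). Riemann problem $(U_l,U_r)$, with $U_l=(\tau_l,u_l,p_l)$, $U_r=(\tau_r,u_r,p_r)$: the outgoing strengths are the numbers $B,C,F>0$ with $U_r=W_+(F;J(C;W_-(B;U_l)))$; they exist (and are unique) if and only if $u_r-u_l<\frac{2}{\gamma-1}\left(\sqrt{\gamma\tau_l p_l}+\sqrt{\gamma\tau_r p_r}\right)$. If this inequality fails, a vacuum is said to form; then the outgoing backward and forward waves are both rarefactions reaching the vacuum, which is recorded as $B<1$ and $F>1$ (formally $B=0$, $F=+\infty$), and $C$ records the entropy jump across the vacuum: $C:=\left(\frac{p_r\tau_r^\gamma}{p_l\tau_l^\gamma}\right)^{1/\gamma}$ (so $C\gtrless1$ iff the specific entropy on the right is larger/smaller than on the left). Interaction of a forward wave $f$ with a contact $c$: the outgoing waves are those of the Riemann problem $(U_l,U_r)$ with $U_m=W_+(f;U_l)$ and $U_r=J(c;U_m)$. The outgoing strengths and the occurrence of a vacuum depend only on $f,c,\gamma$, not on $U_l$. *)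

theory Defs
  imports "HOL-Analysis.Analysis"
begin

text \<open>
  A gas state is a triple (specific volume, velocity, pressure).  The adiabatic constant
  \<open>\<gamma>\<close> is an explicit parameter throughout; it is meant to satisfy \<open>\<gamma> > 1\<close>.
\<close>

type_synonym state = "real \<times> real \<times> real"

definition states :: "state set" where
  "states = {(\<tau>, u, p). \<tau> > 0 \<and> p > 0}"

definition par_a :: "real \<Rightarrow> real" where
  "par_a \<gamma> = (\<gamma> - 1) / (\<gamma> + 1)"

definition par_kappa :: "real \<Rightarrow> real" where
  "par_kappa \<gamma> = sqrt (1 - par_a \<gamma>)"

definition par_nu :: "real \<Rightarrow> real" where
  "par_nu \<gamma> = sqrt (1 - (par_a \<gamma>)\<^sup>2) / par_a \<gamma>"

definition par_zeta :: "real \<Rightarrow> real" where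
  "par_zeta \<gamma> = (\<gamma> - 1) / (2 * \<gamma>)"

definition phi_minus :: "real \<Rightarrow> real \<Rightarrow> real" where
  "phi_minus \<gamma> q =
     (if q \<le> 1 then q powr (- 1 / \<gamma>) else (1 + par_a \<gamma> * q) / (q + par_a \<gamma>))"

definition psi_minus :: "real \<Rightarrow> real \<Rightarrow> real" where
  "psi_minus \<gamma> q =
     (if q \<le> 1 then par_nu \<gamma> * (q powr par_zeta \<gamma> - 1)
      else par_kappa \<gamma> * (q - 1) / sqrt (q + par_a \<gamma>))"

definition phi_plus :: "real \<Rightarrow> real \<Rightarrow> real" where
  "phi_plus \<gamma> q =
     (if q \<le> 1 then (1 + par_a \<gamma> * q) / (q + par_a \<gamma>) else q powr (- 1 / \<gamma>))"

definition psi_plus :: "real \<Rightarrow> real \<Rightarrow> real" where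
  "psi_plus \<gamma> q =
     (if q \<le> 1 then par_kappa \<gamma> * (q - 1) / sqrt (q + par_a \<gamma>)
      else par_nu \<gamma> * (q powr par_zeta \<gamma> - 1))"

text \<open>
  The state on the right of a single backward wave, contact, or forward wave of given
  strength, as a function of the state on its left.
\<close>

definition W_minus :: "real \<Rightarrow> real \<Rightarrow> state \<Rightarrow> state" where
  "W_minus \<gamma> b = (\<lambda>(\<tau>, u, p).
     (phi_minus \<gamma> b * \<tau>, u - psi_minus \<gamma> b * sqrt (\<tau> * p), b * p))"

definition contact :: "real \<Rightarrow> state \<Rightarrow> state" where
  "contact c = (\<lambda>(\<tau>, u, p). (c * \<tau>, u, p))"

definition W_plus :: "real \<Rightarrow> real \<Rightarrow> state \<Rightarrow> state" where
  "W_plus \<gamma> f = (\<lambda>(\<tau>, u, p).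
     (phi_plus \<gamma> f * \<tau>, u + psi_plus \<gamma> f * sqrt (\<tau> * p), f * p))"

definition vacuum :: "real \<Rightarrow> state \<Rightarrow> state \<Rightarrow> bool" where
  "vacuum \<gamma> = (\<lambda>(\<tau>l, ul, pl) (\<tau>r, ur, pr).
     \<not> ur - ul < 2 / (\<gamma> - 1) * (sqrt (\<gamma> * \<tau>l * pl) + sqrt (\<gamma> * \<tau>r * pr)))"

definition vacuum_contact :: "real \<Rightarrow> state \<Rightarrow> state \<Rightarrow> real" where
  "vacuum_contact \<gamma> = (\<lambda>(\<tau>l, ul, pl) (\<tau>r, ur, pr).
     (pr * \<tau>r powr \<gamma> / (pl * \<tau>l powr \<gamma>)) powr (1 / \<gamma>))"

text \<open>
  Outgoing strengths \<open>(B, C, F)\<close> of the Riemann problem.  Without vacuum they are the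
  unique positive solution of the wave curve equation, so any proof about these values
  has to establish existence and uniqueness of that solution; \<open>F\<close> is extended real only
  because of the convention \<open>B = 0\<close>, \<open>F = \<infinity>\<close> in the vacuum case.
\<close>

definition outgoing :: "real \<Rightarrow> state \<Rightarrow> state \<Rightarrow> real \<times> real \<times> ereal" where
  "outgoing \<gamma> Ul Ur =
     (if vacuum \<gamma> Ul Ur then (0, vacuum_contact \<gamma> Ul Ur, \<infinity>)
      else case (THE (B, C, F). 0 < B \<and> 0 < C \<and> 0 < F \<and>
                    Ur = W_plus \<gamma> F (contact C (W_minus \<gamma> B Ul)))
           of (B, C, F) \<Rightarrow> (B, C, ereal F))"

text \<open>
  Interaction of an incoming forward wave \<open>f\<close> on the left with a contact \<open>c\<close> on the
  right, where \<open>Ul\<close> is the leftmost state.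
\<close>

definition right_state :: "real \<Rightarrow> state \<Rightarrow> real \<Rightarrow> real \<Rightarrow> state" where
  "right_state \<gamma> Ul f c = contact c (W_plus \<gamma> f Ul)"

definition forms_vacuum :: "real \<Rightarrow> state \<Rightarrow> real \<Rightarrow> real \<Rightarrow> bool" where
  "forms_vacuum \<gamma> Ul f c \<longleftrightarrow> vacuum \<gamma> Ul (right_state \<gamma> Ul f c)"

definition out_B :: "real \<Rightarrow> state \<Rightarrow> real \<Rightarrow> real \<Rightarrow> real" where
  "out_B \<gamma> Ul f c = fst (outgoing \<gamma> Ul (right_state \<gamma> Ul f c))"

definition out_C :: "real \<Rightarrow> state \<Rightarrow> real \<Rightarrow> real \<Rightarrow> real" where
  "out_C \<gamma> Ul f c = fst (snd (outgoing \<gamma> Ul (right_state \<gamma> Ul f c)))"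

definition out_F :: "real \<Rightarrow> state \<Rightarrow> real \<Rightarrow> real \<Rightarrow> ereal" where
  "out_F \<gamma> Ul f c = snd (snd (outgoing \<gamma> Ul (right_state \<gamma> Ul f c)))"

definition IIa :: "real \<Rightarrow> real \<Rightarrow> bool" where
  "IIa f c \<longleftrightarrow> 0 < f \<and> f < 1 \<and> 0 < c \<and> c < 1"

definition IIb :: "real \<Rightarrow> real \<Rightarrow> bool" where
  "IIb f c \<longleftrightarrow> 0 < f \<and> f < 1 \<and> 1 < c"

definition IIc :: "real \<Rightarrow> real \<Rightarrow> bool" where
  "IIc f c \<longleftrightarrow> 1 < f \<and> 0 < c \<and> c < 1"

definition IId :: "real \<Rightarrow> real \<Rightarrow> bool" where
  "IId f c \<longleftrightarrow> 1 < f \<and> 1 < c"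

definition f_star :: "real \<Rightarrow> real \<Rightarrow> real" where
  "f_star \<gamma> c = (2 / (1 - sqrt c)) powr (1 / par_zeta \<gamma>)"

end

theory Submission
  imports Defs
begin

text \<open>
  Every forward wave is a backward wave seen in a mirror:
  \<open>\<phi>\<^sub>+(q) = 1 / \<phi>\<^sub>-(1/q)\<close> and \<open>\<psi>\<^sub>+(q) = - sqrt (q \<phi>\<^sub>+(q)) \<psi>\<^sub>-(1/q)\<close>.  Eliminating \<open>F\<close>
  (pressure, \<open>F = f / B\<close>) and \<open>C\<close> (specific volume) therefore leaves a single equation for \<open>B\<close>,
  with \<open>h = sqrt (f \<phi>\<^sub>+(f))\<close>:
  \<open>G(B) = \<psi>\<^sub>-(B) + h sqrt c \<psi>\<^sub>-(B/f) - h \<psi>\<^sub>-(1/f) = 0\<close>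
  (\<open>wave_equation_iff\<close>).  The function \<open>\<psi>\<^sub>-\<close> is strictly increasing and vanishes at \<open>1\<close>, so \<open>G\<close>
  is strictly increasing, and the sign of \<open>G\<close> at a point tells on which side of it the root lies.
  The rest consists of evaluations of \<open>G\<close>.

  At \<open>0\<close>: \<open>G(0) < 0\<close> is exactly the absence of a vacuum, and then a root exists by
  continuity.  For \<open>f > 1\<close>, where \<open>h = f\<^sup>\<zeta>\<close>, the condition \<open>G(0) \<ge> 0\<close> reads
  \<open>f\<^sup>\<zeta> (1 - sqrt c) \<ge> 2\<close>.
  At \<open>1\<close>: \<open>G(1) = h (sqrt c - 1) \<psi>\<^sub>-(1/f)\<close> decides between \<open>B < 1\<close> and \<open>B > 1\<close>.
  At \<open>f\<close>: \<open>G(f) = \<psi>\<^sub>-(f) + \<psi>\<^sub>+(f)\<close> has the sign of \<open>f - 1\<close>, which decides between \<open>F < 1\<close>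
  and \<open>F > 1\<close>.

  For the contact, write \<open>T(q) = \<phi>\<^sub>-(q) q\<^sup>1\<^sup>/\<^sup>\<gamma>\<close>, which is \<open>1\<close> on rarefactions and measures the entropy
  produced by shocks.  Then \<open>C / c = T(B/f) / (T(1/f) T(B))\<close> (\<open>contact_out_entropy\<close>).  If
  \<open>f > 1\<close> all forward waves are rarefactions and \<open>C = c / T(B)\<close>; as \<open>T\<close> increases from
  \<open>1\<close> to infinity on \<open>[1, \<infinity>)\<close>, and as for each prescribed \<open>B > 1\<close> the equation \<open>G(B) = 0\<close> is linear in
  \<open>f\<^sup>\<zeta>\<close>, every value in \<open>(0, c)\<close> is reached.  If \<open>f < 1\<close>, comparing \<open>C\<close> with \<open>c\<close> is a matter
  of the entropy of two shocks against that of one (\<open>contact_out_shock_vs_c\<close>).  Comparing \<open>C\<close>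
  with \<open>1\<close> needs the momentum balance as well: it bounds \<open>c\<close> by a ratio of velocity jumps, which the
  monotonicity of the jump relative to the state behind the shock converts into a bound for \<open>C\<close>
  (\<open>contact_out_vs_1\<close>).
\<close>

section \<open>Parameters\<close>

lemma
  assumes "\<gamma> > 1"
  shows par_a_pos: "0 < par_a \<gamma>" and par_a_less_1: "par_a \<gamma> < 1"
    and par_kappa_pos: "0 < par_kappa \<gamma>" and par_nu_pos: "0 < par_nu \<gamma>"
    and par_zeta_pos: "0 < par_zeta \<gamma>"
    and par_nu_eq: "par_nu \<gamma> = 2 / (\<gamma> - 1) * sqrt \<gamma>"
    and par_zeta_eq: "1 - 1 / \<gamma> = 2 * par_zeta \<gamma>"
    and inverse_gamma_eq: "1 / \<gamma> = (1 - par_a \<gamma>) / (1 + par_a \<gamma>)"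
proof -
  show a: "0 < par_a \<gamma>" and a1: "par_a \<gamma> < 1"
    using assms by (auto simp: par_a_def divide_simps)
  then show "0 < par_kappa \<gamma>"
    by (simp add: par_kappa_def)
  show nu: "par_nu \<gamma> = 2 / (\<gamma> - 1) * sqrt \<gamma>"
  proof -
    have "1 - (par_a \<gamma>)\<^sup>2 = (2 / (\<gamma> + 1))\<^sup>2 * \<gamma>"
    proof -
      have "\<gamma> + 1 \<noteq> 0" using assms by simp
      then show ?thesis
        by (simp add: par_a_def power_divide divide_simps) (simp add: power2_eq_square algebra_simps)
    qed
    then have "sqrt (1 - (par_a \<gamma>)\<^sup>2) = 2 / (\<gamma> + 1) * sqrt \<gamma>"
      using assms by (simp add: real_sqrt_mult)
    then show ?thesis
      using assms by (simp add: par_nu_def par_a_def)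
  qed
  show "0 < par_nu \<gamma>" "0 < par_zeta \<gamma>"
    using assms by (simp_all add: nu par_zeta_def)
  show "1 - 1 / \<gamma> = 2 * par_zeta \<gamma>" "1 / \<gamma> = (1 - par_a \<gamma>) / (1 + par_a \<gamma>)"
    using assms by (simp_all add: par_zeta_def par_a_def divide_simps)
qed

section \<open>Wave curves\<close>

lemma phi_minus_pos:
  assumes "\<gamma> > 1" and "q > 0"
  shows "phi_minus \<gamma> q > 0"
  using assms par_a_pos[of \<gamma>] by (auto simp: phi_minus_def intro!: divide_pos_pos add_pos_pos)

text \<open> As far as pressure and specific volume are concerned, crossing a forward wave undoes a backward
  wave of reciprocal strength. \<close>
lemma phi_plus_eq_inverse:
  assumes "\<gamma> > 1" and "q > 0"
  shows "phi_plus \<gamma> q = 1 / phi_minus \<gamma> (1 / q)"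
proof -
  have a: "0 < par_a \<gamma>" using assms by (simp add: par_a_pos)
  have "q + par_a \<gamma> > 0" "1 + q * par_a \<gamma> > 0" using a assms by (simp_all add: add_pos_pos)
  then have "q + par_a \<gamma> \<noteq> 0" "1 + q * par_a \<gamma> \<noteq> 0" by simp_all
  moreover have "(1 + par_a \<gamma> / q) / (1 / q + par_a \<gamma>) = (q + par_a \<gamma>) / (1 + par_a \<gamma> * q)"
    using assms calculation by (simp add: add_divide_eq_iff divide_add_eq_iff mult.commute)
  ultimately have shock: "phi_minus \<gamma> (1 / q) = (q + par_a \<gamma>) / (1 + par_a \<gamma> * q)" if "q < 1"
    using that assms by (simp add: phi_minus_def)
  consider "q < 1" | "q = 1" | "q > 1" by linarith
  then show ?thesis
  proof cases
    case 1
    then show ?thesis by (simp add: shock phi_plus_def)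
  next
    case 2
    then show ?thesis using a by (simp add: phi_plus_def phi_minus_def)
  next
    case 3
    then have "1 / q < 1" by simp
    with 3 show ?thesis by (simp add: phi_plus_def phi_minus_def powr_minus_divide powr_divide)
  qed
qed

lemma phi_plus_pos:
  assumes "\<gamma> > 1" and "q > 0"
  shows "phi_plus \<gamma> q > 0"
  using assms phi_minus_pos[of \<gamma> "1 / q"] by (simp add: phi_plus_eq_inverse)

text \<open> The factor by which \<open>sqrt (\<tau> * p)\<close>, hence the speed of sound, changes across a forward wave. \<close>
definition sound_ratio :: "real \<Rightarrow> real \<Rightarrow> real" where
  "sound_ratio \<gamma> f = sqrt (f * phi_plus \<gamma> f)"

lemma sound_ratio_pos:
  assumes "\<gamma> > 1" and "f > 0"
  shows "sound_ratio \<gamma> f > 0"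
  using assms by (simp add: sound_ratio_def phi_plus_pos)

lemma sound_ratio_rarefaction:
  assumes "\<gamma> > 1" and "f \<ge> 1"
  shows "sound_ratio \<gamma> f = f powr par_zeta \<gamma>"
proof -
  have "f * phi_plus \<gamma> f = f powr (1 - 1 / \<gamma>)"
  proof (cases "f = 1")
    case False
    then show ?thesis
      using assms by (simp add: phi_plus_def powr_diff powr_minus divide_inverse)
  next
    case True
    then show ?thesis
      using par_a_pos[OF assms(1)] by (simp add: phi_plus_def)
  qed
  also have "\<dots> = (f powr par_zeta \<gamma>)\<^sup>2"
    by (simp only: par_zeta_eq[OF assms(1)] power2_eq_square mult_2 powr_add)
  finally show ?thesis by (simp add: sound_ratio_def)
qed

lemma sound_ratio_shock_less_1:
  assumes "\<gamma> > 1" and "0 < f" and "f < 1"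
  shows "sound_ratio \<gamma> f < 1"
proof -
  note a = par_a_pos[OF assms(1)]
  have "f * (1 + par_a \<gamma> * f) < f + par_a \<gamma>"
    using a assms mult_strict_mono[of f 1 f 1] by (simp add: algebra_simps)
  then show ?thesis
    using assms a by (simp add: sound_ratio_def phi_plus_def divide_simps)
qed

text \<open> The velocity part of the mirror symmetry between the two wave families.  The factor
  \<open>sound_ratio\<close> appears because \<open>\<psi>\<close> measures velocity in units of \<open>sqrt (\<tau> * p)\<close> on the left of the
  wave, and the mirror exchanges the two sides. \<close>
lemma psi_plus_eq:
  assumes g: "\<gamma> > 1" and q: "q > 0"
  shows "psi_plus \<gamma> q = - sound_ratio \<gamma> q * psi_minus \<gamma> (1 / q)"
proof (cases "q < 1")
  case True
  note a = par_a_pos[OF g]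
  have "sound_ratio \<gamma> q * (1 / q - 1) / sqrt (1 / q + par_a \<gamma>) = (1 - q) / sqrt (q + par_a \<gamma>)"
  proof -
    have "sound_ratio \<gamma> q = q * sqrt (1 / q + par_a \<gamma>) / sqrt (q + par_a \<gamma>)"
    proof -
      have "q * phi_plus \<gamma> q = q\<^sup>2 * (1 / q + par_a \<gamma>) / (q + par_a \<gamma>)"
        using True q a by (simp add: phi_plus_def divide_simps) (simp add: power2_eq_square algebra_simps)
      then show ?thesis
        using q by (simp add: sound_ratio_def real_sqrt_mult real_sqrt_divide)
    qed
    moreover have "sqrt (1 / q + par_a \<gamma>) > 0" using q a by (simp add: add_pos_pos)
    ultimately have "sound_ratio \<gamma> q * (1 / q - 1) / sqrt (1 / q + par_a \<gamma>)
        = q * (1 / q - 1) / sqrt (q + par_a \<gamma>)"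
      by simp
    then show ?thesis using q by (simp add: right_diff_distrib)
  qed
  then have "par_kappa \<gamma> * (sound_ratio \<gamma> q * (1 / q - 1) / sqrt (1 / q + par_a \<gamma>))
      = par_kappa \<gamma> * ((1 - q) / sqrt (q + par_a \<gamma>))"
    by simp
  then show ?thesis
    using True q by (simp add: psi_plus_def psi_minus_def algebra_simps diff_divide_distrib)
next
  case False
  then have "q \<ge> 1" by simp
  then have "q powr par_zeta \<gamma> * (1 / q) powr par_zeta \<gamma> = 1"
    by (simp flip: powr_mult)
  moreover have "psi_plus \<gamma> q = par_nu \<gamma> * (q powr par_zeta \<gamma> - 1)"
    using \<open>q \<ge> 1\<close> by (cases "q = 1") (auto simp: psi_plus_def)
  ultimately show ?thesis
    using sound_ratio_rarefaction[OF g \<open>q \<ge> 1\<close>] \<open>q \<ge> 1\<close>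
    by (simp add: psi_minus_def algebra_simps)
qed

lemma psi_minus_1 [simp]: "psi_minus \<gamma> 1 = 0"
  by (simp add: psi_minus_def)

text \<open> Since \<open>0 powr \<zeta> = 0\<close>, the rarefaction formula extends to a backward rarefaction reaching the
  vacuum, which gives the vacuum criterion as a value at \<open>0\<close>. \<close>
lemma psi_minus_0: "psi_minus \<gamma> 0 = - par_nu \<gamma>"
  by (simp add: psi_minus_def)

lemma psi_minus_shock_branch:
  assumes "q \<ge> 1"
  shows "psi_minus \<gamma> q = par_kappa \<gamma> * (q - 1) / sqrt (q + par_a \<gamma>)"
  using assms by (cases "q = 1") (auto simp: psi_minus_def)

lemma psi_minus_strict_mono:
  assumes g: "\<gamma> > 1" and "0 \<le> x" and "x < y"
  shows "psi_minus \<gamma> x < psi_minus \<gamma> y"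
proof -
  note a = par_a_pos[OF g] and k = par_kappa_pos[OF g] and n = par_nu_pos[OF g]
    and z = par_zeta_pos[OF g]
  have low: "psi_minus \<gamma> s < psi_minus \<gamma> t" if "0 \<le> s" "s < t" "t \<le> 1" for s t
    using that n z by (simp add: psi_minus_def powr_less_mono2)
  have high: "psi_minus \<gamma> s < psi_minus \<gamma> t" if "1 \<le> s" "s < t" for s t
  proof -
    \<comment> \<open>both summands on the right increase with \<open>q\<close>\<close>
    have split: "(q - 1) / sqrt (q + par_a \<gamma>) = sqrt (q + par_a \<gamma>) - (1 + par_a \<gamma>) / sqrt (q + par_a \<gamma>)"
      if "q \<ge> 1" for q
    proof -
      have "sqrt (q + par_a \<gamma>) > 0" "sqrt (q + par_a \<gamma>) * sqrt (q + par_a \<gamma>) = q + par_a \<gamma>"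
        using that a by auto
      then show ?thesis by (simp add: field_simps)
    qed
    have "(1 + par_a \<gamma>) / sqrt (t + par_a \<gamma>) < (1 + par_a \<gamma>) / sqrt (s + par_a \<gamma>)"
      using that a by (intro divide_strict_left_mono) auto
    moreover have "sqrt (s + par_a \<gamma>) < sqrt (t + par_a \<gamma>)" using that by simp
    ultimately have "(s - 1) / sqrt (s + par_a \<gamma>) < (t - 1) / sqrt (t + par_a \<gamma>)"
      using that by (simp only: split)
    then show ?thesis
      using that mult_strict_left_mono[OF _ k]
      by (simp add: psi_minus_shock_branch flip: times_divide_eq_right)
  qed
  consider "y \<le> 1" | "1 \<le> x" | "x < 1" "1 < y" by linarith
  then show ?thesis
  proof cases
    case 3
    with low[of x 1] high[of 1 y] assms show ?thesis by linarith
  qed (use low[of x y] high[of x y] assms in auto)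
qed

lemma psi_minus_mono:
  assumes "\<gamma> > 1" and "0 \<le> x" and "x \<le> y"
  shows "psi_minus \<gamma> x \<le> psi_minus \<gamma> y"
  using psi_minus_strict_mono[of \<gamma> x y] assms by (cases "x = y") auto

lemma psi_minus_pos_iff:
  assumes "\<gamma> > 1" and "0 \<le> q"
  shows "psi_minus \<gamma> q > 0 \<longleftrightarrow> q > 1" and "psi_minus \<gamma> q < 0 \<longleftrightarrow> q < 1"
  using psi_minus_strict_mono[of \<gamma> q 1] psi_minus_strict_mono[of \<gamma> 1 q] assms
  by (metis less_asym linorder_neqE psi_minus_1 zero_le_one less_irrefl)+

lemma continuous_on_psi_minus:
  assumes g: "\<gamma> > 1"
  shows "continuous_on {0..} (psi_minus \<gamma>)"
proof -
  note a = par_a_pos[OF g] and z = par_zeta_pos[OF g]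
  have "continuous_on ({0..1} \<union> {1..}) (\<lambda>q. if q \<le> 1 then par_nu \<gamma> * (q powr par_zeta \<gamma> - 1)
      else par_kappa \<gamma> * (q - 1) / sqrt (q + par_a \<gamma>))"
  proof (rule continuous_on_If)
    show "continuous_on {0..1} (\<lambda>q. par_nu \<gamma> * (q powr par_zeta \<gamma> - 1))"
      using z by (intro continuous_intros continuous_on_powr') auto
    show "continuous_on {1..} (\<lambda>q. par_kappa \<gamma> * (q - 1) / sqrt (q + par_a \<gamma>))"
      using a by (intro continuous_intros) auto
  qed auto
  moreover have "{0..1} \<union> {1..} = {0::real..}" by auto
  ultimately show ?thesis by (simp add: psi_minus_def[abs_def])
qed

section \<open>Riemann problem\<close>

text \<open> In units of \<open>sqrt (\<tau> * p)\<close> of the leftmost state: the prescribed velocity of the rightmost state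
  minus the velocity reached from the left by a backward wave \<open>B\<close>, the contact, and the forward wave
  \<open>f / B\<close> that restores the pressure. \<close>
definition velocity_gap :: "real \<Rightarrow> real \<Rightarrow> real \<Rightarrow> real \<Rightarrow> real" where
  "velocity_gap \<gamma> f c B =
     psi_minus \<gamma> B + sound_ratio \<gamma> f * sqrt c * psi_minus \<gamma> (B / f)
       - sound_ratio \<gamma> f * psi_minus \<gamma> (1 / f)"

text \<open> The contact strength that makes the specific volumes match, given the strengths \<open>B\<close> and
  \<open>f / B\<close> of the other two outgoing waves. \<close>
definition contact_out :: "real \<Rightarrow> real \<Rightarrow> real \<Rightarrow> real \<Rightarrow> real" where
  "contact_out \<gamma> f c B = c * phi_minus \<gamma> (B / f) / (phi_minus \<gamma> (1 / f) * phi_minus \<gamma> B)"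

lemma velocity_gap_strict_mono:
  assumes "\<gamma> > 1" and "0 < f" and "0 < c" and "0 \<le> x" and "x < y"
  shows "velocity_gap \<gamma> f c x < velocity_gap \<gamma> f c y"
proof -
  have "psi_minus \<gamma> x < psi_minus \<gamma> y"
    using assms by (simp add: psi_minus_strict_mono)
  moreover have "sound_ratio \<gamma> f * sqrt c * psi_minus \<gamma> (x / f)
      \<le> sound_ratio \<gamma> f * sqrt c * psi_minus \<gamma> (y / f)"
    using assms sound_ratio_pos[of \<gamma> f]
    by (intro mult_left_mono psi_minus_mono) (auto simp: divide_simps)
  ultimately show ?thesis by (simp add: velocity_gap_def)
qed

lemma velocity_gap_sign:
  assumes "\<gamma> > 1" and "0 < f" and "0 < c" and "0 < B" and "0 < q"
    and "velocity_gap \<gamma> f c B = 0"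
  shows "B < q \<longleftrightarrow> velocity_gap \<gamma> f c q > 0" and "B > q \<longleftrightarrow> velocity_gap \<gamma> f c q < 0"
  using velocity_gap_strict_mono[of \<gamma> f c B q] velocity_gap_strict_mono[of \<gamma> f c q B] assms
  by (metis less_asym linorder_neqE less_imp_le less_irrefl)+

lemma velocity_gap_at_1:
  "velocity_gap \<gamma> f c 1 = sound_ratio \<gamma> f * ((sqrt c - 1) * psi_minus \<gamma> (1 / f))"
  by (simp add: velocity_gap_def algebra_simps)

lemma velocity_gap_at_f:
  assumes "\<gamma> > 1" and "0 < f"
  shows "velocity_gap \<gamma> f c f = psi_minus \<gamma> f - sound_ratio \<gamma> f * psi_minus \<gamma> (1 / f)"
  using assms by (simp add: velocity_gap_def)

text \<open> Pressure determines \<open>F\<close>, then specific volume determines \<open>C\<close>; what is left of the velocity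
  equation involves \<open>B\<close> only, because the mirror formula replaces \<open>sqrt (\<tau> * p)\<close> ahead of the outgoing
  forward wave by its value in the known rightmost state. \<close>
lemma wave_equation_iff:
  assumes g: "\<gamma> > 1" and Ul: "Ul \<in> states" and pos: "0 < f" "0 < c" "0 < B" "0 < C" "0 < F"
  shows "right_state \<gamma> Ul f c = W_plus \<gamma> F (contact C (W_minus \<gamma> B Ul)) \<longleftrightarrow>
    F = f / B \<and> C = contact_out \<gamma> f c B \<and> velocity_gap \<gamma> f c B = 0"
proof -
  obtain \<tau> u p where U: "Ul = (\<tau>, u, p)" and \<tau>: "\<tau> > 0" and p: "p > 0"
    using Ul by (cases Ul) (auto simp: states_def)
  define r where "r = sqrt (\<tau> * p)"
  have r: "r > 0" using \<tau> p by (simp add: r_def)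
  note phiB = phi_minus_pos[OF g pos(3)]
  have phif: "phi_minus \<gamma> (1 / f) > 0" and phiF: "phi_minus \<gamma> (1 / F) > 0"
    using g pos by (simp_all add: phi_minus_pos)
  have eqn: "right_state \<gamma> Ul f c = W_plus \<gamma> F (contact C (W_minus \<gamma> B Ul)) \<longleftrightarrow>
     c * (phi_plus \<gamma> f * \<tau>) = phi_plus \<gamma> F * (C * (phi_minus \<gamma> B * \<tau>)) \<and>
     u + psi_plus \<gamma> f * r = u - psi_minus \<gamma> B * r
        + psi_plus \<gamma> F * sqrt (C * (phi_minus \<gamma> B * \<tau>) * (B * p)) \<and>
     f * p = F * (B * p)"
    by (simp add: U right_state_def contact_def W_plus_def W_minus_def r_def)
  have pr: "f * p = F * (B * p) \<longleftrightarrow> F = f / B"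
    using p pos by (auto simp: field_simps)
  have vol: "c * (phi_plus \<gamma> f * \<tau>) = phi_plus \<gamma> F * (C * (phi_minus \<gamma> B * \<tau>)) \<longleftrightarrow>
      C = contact_out \<gamma> f c B" if F: "F = f / B"
    using \<tau> g pos phiB phif phiF
    by (auto simp: contact_out_def phi_plus_eq_inverse F field_simps)
  have vel: "u + psi_plus \<gamma> f * r = u - psi_minus \<gamma> B * r
        + psi_plus \<gamma> F * sqrt (C * (phi_minus \<gamma> B * \<tau>) * (B * p)) \<longleftrightarrow>
      velocity_gap \<gamma> f c B = 0" if F: "F = f / B" and C: "C = contact_out \<gamma> f c B"
  proof -
    have "C * (phi_minus \<gamma> B * \<tau>) * (B * p) * (F * phi_plus \<gamma> F)
        = c * (f * phi_plus \<gamma> f) * (\<tau> * p)"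
      using g pos phiB phif phiF unfolding C
      by (simp add: contact_out_def phi_plus_eq_inverse F field_simps)
    then have "sqrt (C * (phi_minus \<gamma> B * \<tau>) * (B * p) * (F * phi_plus \<gamma> F))
        = sqrt (c * (f * phi_plus \<gamma> f) * (\<tau> * p))"
      by (rule arg_cong)
    then have *: "sqrt (C * (phi_minus \<gamma> B * \<tau>) * (B * p)) * sound_ratio \<gamma> F
        = sqrt c * sound_ratio \<gamma> f * r"
      unfolding sound_ratio_def r_def by (simp only: real_sqrt_mult)
    have "psi_plus \<gamma> F * sqrt (C * (phi_minus \<gamma> B * \<tau>) * (B * p))
        = - psi_minus \<gamma> (1 / F) *
            (sqrt (C * (phi_minus \<gamma> B * \<tau>) * (B * p)) * sound_ratio \<gamma> F)"
      using psi_plus_eq[OF g pos(5)] by simp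
    also have "\<dots> = - (sound_ratio \<gamma> f * sqrt c * psi_minus \<gamma> (B / f)) * r"
      unfolding * by (simp add: F)
    finally have "u + psi_plus \<gamma> f * r = u - psi_minus \<gamma> B * r
        + psi_plus \<gamma> F * sqrt (C * (phi_minus \<gamma> B * \<tau>) * (B * p)) \<longleftrightarrow>
        velocity_gap \<gamma> f c B * r = 0"
      using psi_plus_eq[OF g pos(1)] by (auto simp: velocity_gap_def algebra_simps)
    then show ?thesis using r by simp
  qed
  show ?thesis
    unfolding eqn using pr vol vel by blast
qed

text \<open> The vacuum threshold is the velocity difference spanned by two complete rarefactions, since
  \<open>\<nu> = 2 sqrt \<gamma> / (\<gamma> - 1)\<close>; this is the gap at \<open>B = 0\<close>. \<close>
lemma forms_vacuum_iff:
  assumes g: "\<gamma> > 1" and Ul: "Ul \<in> states" and pos: "0 < f" "0 < c"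
  shows "forms_vacuum \<gamma> Ul f c \<longleftrightarrow>
    psi_plus \<gamma> f \<ge> par_nu \<gamma> * (1 + sound_ratio \<gamma> f * sqrt c)"
    and "forms_vacuum \<gamma> Ul f c \<longleftrightarrow> velocity_gap \<gamma> f c 0 \<ge> 0"
proof -
  obtain \<tau> u p where U: "Ul = (\<tau>, u, p)" and \<tau>: "\<tau> > 0" and p: "p > 0"
    using Ul by (cases Ul) (auto simp: states_def)
  define r where "r = sqrt (\<tau> * p)"
  have r: "r > 0" using \<tau> p by (simp add: r_def)
  have "sqrt (\<gamma> * (c * (phi_plus \<gamma> f * \<tau>)) * (f * p)) = sqrt (\<gamma> * c * (f * phi_plus \<gamma> f) * (\<tau> * p))"
    by (simp add: mult_ac)
  also have "\<dots> = sqrt \<gamma> * (sound_ratio \<gamma> f * sqrt c) * r"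
    by (simp add: sound_ratio_def r_def real_sqrt_mult mult_ac)
  finally have s1: "sqrt (\<gamma> * (c * (phi_plus \<gamma> f * \<tau>)) * (f * p)) = sqrt \<gamma> * (sound_ratio \<gamma> f * sqrt c) * r" .
  have s2: "sqrt (\<gamma> * \<tau> * p) = sqrt \<gamma> * r"
    by (simp add: r_def real_sqrt_mult mult_ac)
  have "forms_vacuum \<gamma> Ul f c \<longleftrightarrow>
      2 / (\<gamma> - 1) * (sqrt \<gamma> * r + sqrt \<gamma> * (sound_ratio \<gamma> f * sqrt c) * r) \<le> psi_plus \<gamma> f * r"
    by (simp only: forms_vacuum_def vacuum_def right_state_def contact_def W_plus_def U
        prod.case s1 s2 r_def[symmetric] not_less) (simp add: algebra_simps)
  also have "2 / (\<gamma> - 1) * (sqrt \<gamma> * r + sqrt \<gamma> * (sound_ratio \<gamma> f * sqrt c) * r)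
      = par_nu \<gamma> * (1 + sound_ratio \<gamma> f * sqrt c) * r"
    by (simp add: par_nu_eq[OF g] divide_inverse algebra_simps)
  finally show *: "forms_vacuum \<gamma> Ul f c \<longleftrightarrow>
    psi_plus \<gamma> f \<ge> par_nu \<gamma> * (1 + sound_ratio \<gamma> f * sqrt c)"
    using r by simp
  show "forms_vacuum \<gamma> Ul f c \<longleftrightarrow> velocity_gap \<gamma> f c 0 \<ge> 0"
    unfolding * velocity_gap_def psi_plus_eq[OF g pos(1)]
    by (auto simp: psi_minus_0 algebra_simps)
qed

text \<open> The gap is strictly monotone, so it has only one root; this is the uniqueness on which the
  definite description in \<open>outgoing\<close> rests. \<close>
lemma outgoing_eq:
  assumes g: "\<gamma> > 1" and Ul: "Ul \<in> states" and pos: "0 < f" "0 < c" "0 < B"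
    and gap: "velocity_gap \<gamma> f c B = 0"
  shows "\<not> forms_vacuum \<gamma> Ul f c" and "out_B \<gamma> Ul f c = B"
    and "out_C \<gamma> Ul f c = contact_out \<gamma> f c B" and "out_F \<gamma> Ul f c = ereal (f / B)"
proof -
  have "velocity_gap \<gamma> f c 0 < 0"
    using velocity_gap_strict_mono[of \<gamma> f c 0 B] g pos gap by simp
  then show nv: "\<not> forms_vacuum \<gamma> Ul f c"
    using forms_vacuum_iff(2)[OF g Ul pos(1,2)] by simp
  have Cpos: "contact_out \<gamma> f c B > 0"
    using phi_minus_pos[OF g] pos by (simp add: contact_out_def)
  have "(THE (B, C, F). 0 < B \<and> 0 < C \<and> 0 < F \<and>
      right_state \<gamma> Ul f c = W_plus \<gamma> F (contact C (W_minus \<gamma> B Ul)))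
      = (B, contact_out \<gamma> f c B, f / B)"
  proof (rule the_equality)
    show "case (B, contact_out \<gamma> f c B, f / B) of (B, C, F) \<Rightarrow> 0 < B \<and> 0 < C \<and> 0 < F \<and>
        right_state \<gamma> Ul f c = W_plus \<gamma> F (contact C (W_minus \<gamma> B Ul))"
      using wave_equation_iff[OF g Ul pos Cpos, of "f / B"] pos Cpos gap by simp
  next
    fix X
    assume X: "case X of (B, C, F) \<Rightarrow> 0 < B \<and> 0 < C \<and> 0 < F \<and>
        right_state \<gamma> Ul f c = W_plus \<gamma> F (contact C (W_minus \<gamma> B Ul))"
    obtain B' C' F' where XX: "X = (B', C', F')" by (cases X)
    with X have pos': "0 < B'" "0 < C'" "0 < F'"
      and eq: "right_state \<gamma> Ul f c = W_plus \<gamma> F' (contact C' (W_minus \<gamma> B' Ul))"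
      by auto
    from wave_equation_iff[OF g Ul pos(1,2) pos'] eq
    have sol: "F' = f / B'" "C' = contact_out \<gamma> f c B'" "velocity_gap \<gamma> f c B' = 0"
      by auto
    have "B' = B"
      using velocity_gap_sign[OF g pos(1,2) pos(3) pos'(1) gap] sol(3) by (metis less_irrefl linorder_neqE)
    then show "X = (B, contact_out \<gamma> f c B, f / B)"
      using XX sol by simp
  qed
  then have "outgoing \<gamma> Ul (right_state \<gamma> Ul f c) = (B, contact_out \<gamma> f c B, ereal (f / B))"
    using nv by (simp add: outgoing_def forms_vacuum_def)
  then show "out_B \<gamma> Ul f c = B" "out_C \<gamma> Ul f c = contact_out \<gamma> f c B"
    "out_F \<gamma> Ul f c = ereal (f / B)"
    by (simp_all add: out_B_def out_C_def out_F_def)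
qed

text \<open> Intermediate value theorem on \<open>[0, M]\<close>, with \<open>M = 1 / f\<close> or \<open>M = f\<close>. \<close>
lemma velocity_gap_root_exists:
  assumes g: "\<gamma> > 1" and Ul: "Ul \<in> states" and pos: "0 < f" "0 < c" and "f \<noteq> 1"
    and nv: "\<not> forms_vacuum \<gamma> Ul f c"
  obtains B where "0 < B" and "velocity_gap \<gamma> f c B = 0"
proof -
  have h: "sound_ratio \<gamma> f > 0" by (rule sound_ratio_pos[OF g pos(1)])
  have neg: "velocity_gap \<gamma> f c 0 < 0"
    using nv forms_vacuum_iff(2)[OF g Ul pos] by simp
  obtain M where M: "M > 0" "velocity_gap \<gamma> f c M > 0"
  proof (cases "f < 1")
    case True
    \<comment> \<open>at \<open>1 / f\<close> the first and last terms of the gap combine to \<open>(1 - h) \<psi>\<^sub>-(1 / f)\<close> with \<open>h < 1\<close>\<close>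
    have "psi_minus \<gamma> (1 / f) > 0" "psi_minus \<gamma> (1 / f / f) > 0"
      using True pos mult_strict_mono[of f 1 f 1] by (auto simp: psi_minus_pos_iff[OF g] divide_simps)
    moreover have "1 - sound_ratio \<gamma> f > 0"
      using sound_ratio_shock_less_1[OF g pos(1) True] by simp
    ultimately have "(1 - sound_ratio \<gamma> f) * psi_minus \<gamma> (1 / f)
        + sound_ratio \<gamma> f * sqrt c * psi_minus \<gamma> (1 / f / f) > 0"
      using h pos by (intro add_pos_pos mult_pos_pos) auto
    then have "velocity_gap \<gamma> f c (1 / f) > 0"
      by (simp add: velocity_gap_def algebra_simps)
    then show ?thesis using that[of "1 / f"] pos by simp
  next
    case False
    with \<open>f \<noteq> 1\<close> have f: "f > 1" by simp
    \<comment> \<open>at \<open>f\<close> the contact term vanishes and the other two are positive\<close>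
    have "psi_minus \<gamma> f > 0" "psi_minus \<gamma> (1 / f) < 0"
      using f by (auto simp: psi_minus_pos_iff[OF g])
    then have "velocity_gap \<gamma> f c f > 0"
      using velocity_gap_at_f[OF g pos(1)] mult_pos_neg[OF h, of "psi_minus \<gamma> (1 / f)"] by simp
    then show ?thesis using that[of f] pos by simp
  qed
  have "continuous_on {0..M} (velocity_gap \<gamma> f c)"
    unfolding velocity_gap_def[abs_def] using pos
    by (intro continuous_intros continuous_on_compose2[OF continuous_on_psi_minus[OF g]]) auto
  with IVT'[of "velocity_gap \<gamma> f c" 0 0 M] neg M
  obtain B where "0 \<le> B" "velocity_gap \<gamma> f c B = 0" by auto
  moreover from this neg have "B \<noteq> 0" by auto
  ultimately show ?thesis using that[of B] by simp
qed

section \<open>Entropy\<close>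

text \<open> The ratio of \<open>p powr (1 / \<gamma>) * \<tau>\<close> across a backward wave; \<open>p * \<tau> powr \<gamma>\<close> is an increasing function
  of the specific entropy. \<close>
definition entropy_factor :: "real \<Rightarrow> real \<Rightarrow> real" where
  "entropy_factor \<gamma> q = phi_minus \<gamma> q * q powr (1 / \<gamma>)"

lemma entropy_factor_rarefaction:
  assumes "0 < q" and "q \<le> 1"
  shows "entropy_factor \<gamma> q = 1"
  using assms by (simp add: entropy_factor_def phi_minus_def flip: powr_add)

lemma entropy_factor_pos:
  assumes "\<gamma> > 1" and "0 < q"
  shows "entropy_factor \<gamma> q > 0"
  using assms by (simp add: entropy_factor_def phi_minus_pos)

text \<open> Both paths from the leftmost to the rightmost state change the pressure by the same factor, so the
  powers of pressure cancel and only entropy changes remain. \<close>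
lemma contact_out_entropy:
  assumes g: "\<gamma> > 1" and pos: "0 < f" "0 < B"
  shows "contact_out \<gamma> f c B =
    c * entropy_factor \<gamma> (B / f) / (entropy_factor \<gamma> (1 / f) * entropy_factor \<gamma> B)"
proof -
  have "(B / f) powr (1 / \<gamma>) = (1 / f) powr (1 / \<gamma>) * B powr (1 / \<gamma>)"
    using pos by (simp flip: powr_mult)
  moreover have "(1 / f) powr (1 / \<gamma>) * B powr (1 / \<gamma>) \<noteq> 0"
    using pos by simp
  ultimately show ?thesis
    by (simp add: contact_out_def entropy_factor_def)
qed

lemma phi_minus_shock_branch:
  assumes "\<gamma> > 1" and "q \<ge> 1"
  shows "phi_minus \<gamma> q = (1 + par_a \<gamma> * q) / (q + par_a \<gamma>)"
  using assms par_a_pos[OF assms(1)] by (cases "q = 1") (auto simp: phi_minus_def)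

text \<open> Stronger shocks produce more entropy.  The logarithmic derivative is, thanks to
  \<open>1 / \<gamma> = (1 - a) / (1 + a)\<close>, a positive multiple of \<open>(q - 1)\<^sup>2\<close>. \<close>
lemma entropy_factor_strict_mono:
  assumes g: "\<gamma> > 1" and "1 \<le> x" and "x < y"
  shows "entropy_factor \<gamma> x < entropy_factor \<gamma> y"
proof -
  define a where "a = par_a \<gamma>"
  have a: "0 < a" "a < 1" using par_a_pos[OF g] par_a_less_1[OF g] by (simp_all add: a_def)
  define L where "L q = ln (1 + a * q) - ln (q + a) + 1 / \<gamma> * ln q" for q
  have L: "entropy_factor \<gamma> q = exp (L q)" if "q \<ge> 1" for q
  proof -
    have p: "1 + a * q > 0" "q + a > 0" "q > 0" using that a by (auto intro: add_pos_pos)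
    then have "exp (ln (1 + a * q) - ln (q + a)) = phi_minus \<gamma> q"
      by (simp add: phi_minus_shock_branch[OF g that] exp_diff flip: a_def)
    moreover have "exp (1 / \<gamma> * ln q) = q powr (1 / \<gamma>)"
      using p by (simp add: powr_def)
    ultimately show ?thesis
      by (simp only: entropy_factor_def L_def exp_add)
  qed
  have deriv: "\<exists>l. (L has_real_derivative l) (at q) \<and> l > 0" if "q > 1" for q
  proof (intro exI conjI)
    have p: "1 + a * q > 0" "q + a > 0" "q > 0" using that a by (auto intro: add_pos_pos)
    show "(L has_real_derivative (a / (1 + a * q) - 1 / (q + a) + 1 / \<gamma> * (1 / q))) (at q)"
      unfolding L_def[abs_def] using p g by (auto intro!: derivative_eq_intros)
    have "a / (1 + a * q) - 1 / (q + a) + 1 / \<gamma> * (1 / q)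
        = (1 - a) * a * (q - 1)\<^sup>2 / ((1 + a) * q * (1 + a * q) * (q + a))"
    proof -
      have nz: "1 + a * q \<noteq> 0" "q + a \<noteq> 0" "q \<noteq> 0" "1 + a \<noteq> 0" using p a by auto
      have "1 / \<gamma> = (1 - a) / (1 + a)" using inverse_gamma_eq[OF g] by (simp add: a_def)
      then have "a / (1 + a * q) - 1 / (q + a) + 1 / \<gamma> * (1 / q)
          = a / (1 + a * q) - 1 / (q + a) + (1 - a) / (1 + a) * (1 / q)" by simp
      also have "\<dots> = (1 - a) * a * (q - 1)\<^sup>2 / ((1 + a) * q * (1 + a * q) * (q + a))"
        using nz by (simp add: divide_simps) (simp add: power2_eq_square algebra_simps)
      finally show ?thesis .
    qed
    also have "\<dots> > 0" using p a that by simp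
    finally show "a / (1 + a * q) - 1 / (q + a) + 1 / \<gamma> * (1 / q) > 0" .
  qed
  have "L x < L y"
  proof (rule DERIV_pos_imp_increasing_open[where f = L])
    show "continuous_on {x..y} L"
      unfolding L_def[abs_def] using assms a
      by (intro continuous_intros) (auto simp: add_pos_pos less_imp_neq[symmetric])
  qed (use assms deriv in auto)
  then show ?thesis using assms by (simp add: L)
qed

lemma entropy_factor_shock:
  assumes "\<gamma> > 1" and "q > 1"
  shows "entropy_factor \<gamma> q > 1"
  using entropy_factor_strict_mono[of \<gamma> 1 q] entropy_factor_rarefaction[of 1 \<gamma>] assms by simp

lemma entropy_factor_surj:
  assumes g: "\<gamma> > 1" and "t > 1"
  obtains q where "q > 1" and "entropy_factor \<gamma> q = t"
proof -
  define a where "a = par_a \<gamma>"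
  have a: "0 < a" "a < 1" using par_a_pos[OF g] par_a_less_1[OF g] by (simp_all add: a_def)
  have ta: "t / a > 1" using a assms by (simp add: less_divide_eq_1)
  \<comment> \<open>\<open>\<phi>\<^sub>-\<close> stays above its limit \<open>a\<close> at infinity, so the factor is at least \<open>a * M powr (1 / \<gamma>) = t\<close>\<close>
  define M where "M = (t / a) powr \<gamma>"
  have M: "M \<ge> 1" using ta g by (simp add: M_def ge_one_powr_ge_zero)
  have phiM: "phi_minus \<gamma> M \<ge> a"
  proof -
    have "a * (M + a) \<le> 1 + a * M"
      using a mult_strict_mono[of a 1 a 1] by (simp add: algebra_simps)
    then show ?thesis
      using M a by (simp add: phi_minus_shock_branch[OF g] pos_le_divide_eq add_pos_pos flip: a_def)
  qed
  have "M powr (1 / \<gamma>) = t / a"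
    using g ta assms(2) a by (simp add: M_def powr_powr)
  then have "entropy_factor \<gamma> M \<ge> a * (t / a)"
    unfolding entropy_factor_def using phiM ta a by (intro mult_mono) auto
  then have top: "t \<le> entropy_factor \<gamma> M" using a by simp
  have "continuous_on {1..M} (\<lambda>q. (1 + a * q) / (q + a) * q powr (1 / \<gamma>))"
    using a by (intro continuous_intros) auto
  then have "continuous_on {1..M} (entropy_factor \<gamma>)"
    by (rule continuous_on_eq)
       (auto simp: entropy_factor_def phi_minus_shock_branch[OF g] a_def)
  then obtain q where q: "1 \<le> q" "entropy_factor \<gamma> q = t"
    using IVT'[of "entropy_factor \<gamma>" 1 t M] top M assms(2) entropy_factor_rarefaction[of 1 \<gamma>]
    by auto
  then have "q \<noteq> 1" using entropy_factor_rarefaction[of 1 \<gamma>] assms(2) by auto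
  with q show ?thesis using that[of q] by simp
qed

text \<open> One shock compresses less than two shocks that lead to the same pressure.  After clearing
  denominators the two sides differ by \<open>a (1 - a) (x y - 1) (x - 1) (y - 1)\<close>. \<close>
lemma phi_minus_supermult:
  assumes g: "\<gamma> > 1" and x: "x > 1" and y: "y > 1"
  shows "phi_minus \<gamma> x * phi_minus \<gamma> y < phi_minus \<gamma> (x * y)"
proof -
  define a where "a = par_a \<gamma>"
  have a: "0 < a" "a < 1" using par_a_pos[OF g] par_a_less_1[OF g] by (simp_all add: a_def)
  have xy: "x * y > 1" using x y by (simp add: less_1_mult)
  have "(1 + a * (x * y)) * ((x + a) * (y + a)) - (1 + a * x) * (1 + a * y) * (x * y + a)
      = a * (1 - a) * (x * y - 1) * (x - 1) * (y - 1)"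
    by (simp add: algebra_simps)
  also have "\<dots> > 0" using a x y xy by simp
  finally have "(1 + a * x) * (1 + a * y) * (x * y + a) < (1 + a * (x * y)) * ((x + a) * (y + a))"
    by simp
  moreover have "(x + a) * (y + a) > 0" "x * y + a > 0"
    using a x y xy by (simp_all add: add_pos_pos)
  ultimately have "(1 + a * x) * (1 + a * y) / ((x + a) * (y + a)) < (1 + a * (x * y)) / (x * y + a)"
    by (simp only: pos_divide_less_eq times_divide_eq_left pos_less_divide_eq)
  then show ?thesis
    using x y xy by (simp add: phi_minus_shock_branch[OF g] flip: a_def)
qed

section \<open>Signs of the outgoing waves\<close>

text \<open> At \<open>B = 1\<close> the gap is due to the contact alone: it has the sign of \<open>(sqrt c - 1) \<psi>\<^sub>-(1 / f)\<close>. \<close>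
lemma root_vs_1:
  assumes g: "\<gamma> > 1" and pos: "0 < f" "0 < c" "0 < B" and f: "f \<noteq> 1"
    and gap: "velocity_gap \<gamma> f c B = 0"
  shows "B > 1 \<longleftrightarrow> (if f < 1 then c < 1 else c > 1)"
    and "B < 1 \<longleftrightarrow> (if f < 1 then c > 1 else c < 1)"
proof -
  have c: "sqrt c - 1 < 0 \<longleftrightarrow> c < 1" "sqrt c - 1 > 0 \<longleftrightarrow> c > 1" by auto
  have p: "psi_minus \<gamma> (1 / f) > 0 \<longleftrightarrow> f < 1" "psi_minus \<gamma> (1 / f) < 0 \<longleftrightarrow> f > 1"
    using pos by (simp_all add: psi_minus_pos_iff[OF g])
  have "B > 1 \<longleftrightarrow> (sqrt c - 1) * psi_minus \<gamma> (1 / f) < 0"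
    "B < 1 \<longleftrightarrow> (sqrt c - 1) * psi_minus \<gamma> (1 / f) > 0"
    using velocity_gap_sign[OF g pos _ gap, of 1] sound_ratio_pos[OF g pos(1)]
    by (simp_all add: velocity_gap_at_1 mult_less_0_iff zero_less_mult_iff)
  then show "B > 1 \<longleftrightarrow> (if f < 1 then c < 1 else c > 1)"
    "B < 1 \<longleftrightarrow> (if f < 1 then c > 1 else c < 1)"
    using f p c by (auto simp: mult_less_0_iff zero_less_mult_iff)
qed

text \<open> At \<open>B = f\<close> there is no outgoing forward wave, and the gap \<open>\<psi>\<^sub>-(f) + \<psi>\<^sub>+(f)\<close> has the sign of
  \<open>f - 1\<close> whatever the contact is. \<close>
lemma root_vs_f:
  assumes g: "\<gamma> > 1" and pos: "0 < f" "0 < c" "0 < B" and f: "f \<noteq> 1"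
    and gap: "velocity_gap \<gamma> f c B = 0"
  shows "B < f \<longleftrightarrow> f > 1" and "B > f \<longleftrightarrow> f < 1"
proof -
  have "f > 1 \<Longrightarrow> psi_minus \<gamma> f > 0 \<and> sound_ratio \<gamma> f * psi_minus \<gamma> (1 / f) < 0"
    and "f < 1 \<Longrightarrow> psi_minus \<gamma> f < 0 \<and> sound_ratio \<gamma> f * psi_minus \<gamma> (1 / f) > 0"
    using pos sound_ratio_pos[OF g pos(1)]
    by (auto simp: psi_minus_pos_iff[OF g] mult_less_0_iff zero_less_mult_iff)
  then show "B < f \<longleftrightarrow> f > 1" "B > f \<longleftrightarrow> f < 1"
    using velocity_gap_sign[OF g pos pos(1) gap] f
    by (smt (verit) velocity_gap_at_f[OF g pos(1)])+
qed

section \<open>Vacuum\<close>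

lemma no_vacuum_shock:
  assumes g: "\<gamma> > 1" and Ul: "Ul \<in> states" and pos: "0 < f" "0 < c" and f: "f < 1"
  shows "\<not> forms_vacuum \<gamma> Ul f c"
proof -
  have "psi_plus \<gamma> f < 0"
    using psi_plus_eq[OF g pos(1)] sound_ratio_pos[OF g pos(1)] psi_minus_pos_iff(1)[OF g, of "1 / f"] f pos
    by (simp add: mult_pos_pos)
  moreover have "par_nu \<gamma> * (1 + sound_ratio \<gamma> f * sqrt c) > 0"
    using par_nu_pos[OF g] sound_ratio_pos[OF g pos(1)] pos by (simp add: add_pos_pos)
  ultimately show ?thesis
    by (simp add: forms_vacuum_iff(1)[OF g Ul pos])
qed

lemma vacuum_rarefaction_iff:
  assumes g: "\<gamma> > 1" and Ul: "Ul \<in> states" and f: "1 < f" and c: "0 < c"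
  shows "forms_vacuum \<gamma> Ul f c \<longleftrightarrow> f powr par_zeta \<gamma> * (1 - sqrt c) \<ge> 2"
proof -
  have "forms_vacuum \<gamma> Ul f c \<longleftrightarrow>
      par_nu \<gamma> * (1 + f powr par_zeta \<gamma> * sqrt c) \<le> par_nu \<gamma> * (f powr par_zeta \<gamma> - 1)"
    using f c by (simp add: forms_vacuum_iff(1)[OF g Ul] sound_ratio_rarefaction[OF g] psi_plus_def)
  also have "\<dots> \<longleftrightarrow> 1 + f powr par_zeta \<gamma> * sqrt c \<le> f powr par_zeta \<gamma> - 1"
    using par_nu_pos[OF g] by simp
  finally show ?thesis by (auto simp: algebra_simps)
qed

lemma vacuum_iff_f_star:
  assumes g: "\<gamma> > 1" and Ul: "Ul \<in> states" and f: "1 < f" and c: "0 < c" "c < 1"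
  shows "forms_vacuum \<gamma> Ul f c \<longleftrightarrow> f \<ge> f_star \<gamma> c"
proof -
  note z = par_zeta_pos[OF g]
  have s: "1 - sqrt c > 0" using c by simp
  have "f_star \<gamma> c \<le> f \<longleftrightarrow> f_star \<gamma> c powr par_zeta \<gamma> \<le> f powr par_zeta \<gamma>"
    using f z s powr_mono2[of "par_zeta \<gamma>" "f_star \<gamma> c" f]
      powr_less_mono2[of "par_zeta \<gamma>" f "f_star \<gamma> c"]
    by (force simp: f_star_def not_le)
  also have "f_star \<gamma> c powr par_zeta \<gamma> = 2 / (1 - sqrt c)"
    using z s by (simp add: f_star_def powr_powr)
  also have "2 / (1 - sqrt c) \<le> f powr par_zeta \<gamma> \<longleftrightarrow> 2 \<le> f powr par_zeta \<gamma> * (1 - sqrt c)"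
    using s by (simp add: pos_divide_le_eq)
  finally show ?thesis by (simp add: vacuum_rarefaction_iff[OF g Ul f c(1)])
qed

lemma no_vacuum_rarefaction:
  assumes g: "\<gamma> > 1" and Ul: "Ul \<in> states" and f: "1 < f" and c: "1 < c"
  shows "\<not> forms_vacuum \<gamma> Ul f c"
proof -
  have "f powr par_zeta \<gamma> * (1 - sqrt c) < 0"
    using f c by (simp add: mult_pos_neg)
  then show ?thesis using c by (simp add: vacuum_rarefaction_iff[OF g Ul f])
qed

text \<open> Rarefactions are isentropic, so the entropy jump across the vacuum is that of the incoming contact. \<close>
lemma outgoing_vacuum:
  assumes g: "\<gamma> > 1" and Ul: "Ul \<in> states" and f: "1 < f" and c: "0 < c"
    and vac: "forms_vacuum \<gamma> Ul f c"
  shows "out_B \<gamma> Ul f c = 0" and "out_C \<gamma> Ul f c = c" and "out_F \<gamma> Ul f c = \<infinity>"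
proof -
  obtain \<tau> u p where U: "Ul = (\<tau>, u, p)" and \<tau>: "\<tau> > 0" and p: "p > 0"
    using Ul by (cases Ul) (auto simp: states_def)
  have out: "outgoing \<gamma> Ul (right_state \<gamma> Ul f c)
      = (0, vacuum_contact \<gamma> Ul (right_state \<gamma> Ul f c), \<infinity>)"
    using vac by (simp add: outgoing_def forms_vacuum_def)
  then show "out_B \<gamma> Ul f c = 0" "out_F \<gamma> Ul f c = \<infinity>"
    by (simp_all add: out_B_def out_F_def)
  have "(f powr (- 1 / \<gamma>)) powr \<gamma> = f powr (- 1)"
    using g by (simp only: powr_powr) simp
  then have "(f powr (- 1 / \<gamma>)) powr \<gamma> = 1 / f"
    using f by (simp add: powr_minus_divide)
  then have "(c * (f powr (- 1 / \<gamma>) * \<tau>)) powr \<gamma> = c powr \<gamma> * (\<tau> powr \<gamma> / f)"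
    using c f \<tau> by (simp add: powr_mult)
  then have "f * p * (c * (f powr (- 1 / \<gamma>) * \<tau>)) powr \<gamma> / (p * \<tau> powr \<gamma>) = c powr \<gamma>"
    using f p \<tau> by simp
  then have "vacuum_contact \<gamma> Ul (right_state \<gamma> Ul f c) = (c powr \<gamma>) powr (1 / \<gamma>)"
    using f by (simp add: U vacuum_contact_def right_state_def contact_def W_plus_def phi_plus_def)
  also have "\<dots> = c" using c g by (simp add: powr_powr)
  finally show "out_C \<gamma> Ul f c = c"
    by (simp add: out_C_def out)
qed

section \<open>The outgoing contact\<close>

text \<open> With \<open>\<tau> = p = 1\<close> ahead of a backward shock, \<open>q * phi_minus \<gamma> q\<close> is the value of \<open>\<tau> * p\<close> behind it.
  So this says that the squared velocity jump, relative to \<open>\<tau> * p\<close> behind the shock, increases with the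
  strength; that quotient is \<open>\<kappa>\<^sup>2\<close> times \<open>(q - 1) / q\<close> times \<open>(q - 1) / (1 + a q)\<close>, two
  increasing factors. \<close>
lemma shock_jump_mono:
  assumes g: "\<gamma> > 1" and x: "1 \<le> x" and xy: "x \<le> y"
  shows "(psi_minus \<gamma> x)\<^sup>2 * (y * phi_minus \<gamma> y) \<le> (psi_minus \<gamma> y)\<^sup>2 * (x * phi_minus \<gamma> x)"
proof -
  define a where "a = par_a \<gamma>"
  have a: "a > 0" using par_a_pos[OF g] by (simp add: a_def)
  define m where "m q = (q - 1) / q * ((q - 1) / (1 + a * q))" for q
  have jump: "(psi_minus \<gamma> q)\<^sup>2 = (par_kappa \<gamma>)\<^sup>2 * m q * (q * phi_minus \<gamma> q)"
    if "q \<ge> 1" for q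
  proof -
    have p: "q + a > 0" "1 + a * q > 0" "q > 0" using that a by (simp_all add: add_pos_pos)
    have "(psi_minus \<gamma> q)\<^sup>2 = (par_kappa \<gamma>)\<^sup>2 * (q - 1)\<^sup>2 / (q + a)"
      using p by (simp add: psi_minus_shock_branch[OF that] power_divide power_mult_distrib flip: a_def)
    also have "\<dots> = (par_kappa \<gamma>)\<^sup>2 * m q * (q * phi_minus \<gamma> q)"
      using p by (simp add: m_def phi_minus_shock_branch[OF g that] power2_eq_square flip: a_def)
    finally show ?thesis .
  qed
  have "(x - 1) / x \<le> (y - 1) / y"
    using x xy by (simp add: divide_simps algebra_simps)
  moreover have "(x - 1) / (1 + a * x) \<le> (y - 1) / (1 + a * y)"
  proof (rule frac_le_eq[THEN iffD2])
    show "1 + a * x \<noteq> 0" "1 + a * y \<noteq> 0"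
      using x xy a by (simp_all add: add_pos_pos less_imp_neq[symmetric])
    have "(x - 1) * (1 + a * y) - (y - 1) * (1 + a * x) = - ((1 + a) * (y - x))"
      by (simp add: algebra_simps)
    also have "\<dots> \<le> 0" using a xy by simp
    finally show "((x - 1) * (1 + a * y) - (y - 1) * (1 + a * x)) / ((1 + a * x) * (1 + a * y)) \<le> 0"
      using x xy a by (simp add: divide_nonpos_pos add_pos_pos)
  qed
  ultimately have "m x \<le> m y"
    unfolding m_def using x xy a by (intro mult_mono) (auto intro!: divide_nonneg_nonneg)
  moreover have "(par_kappa \<gamma>)\<^sup>2 * (x * phi_minus \<gamma> x) * (y * phi_minus \<gamma> y) \<ge> 0"
    using phi_minus_pos[OF g, of x] phi_minus_pos[OF g, of y] x xy by simp
  ultimately have "m x * ((par_kappa \<gamma>)\<^sup>2 * (x * phi_minus \<gamma> x) * (y * phi_minus \<gamma> y))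
      \<le> m y * ((par_kappa \<gamma>)\<^sup>2 * (x * phi_minus \<gamma> x) * (y * phi_minus \<gamma> y))"
    by (rule mult_right_mono)
  then show ?thesis
    using x xy by (simp only: jump order_trans[OF x xy] mult_ac)
qed

text \<open> The gas heats up when compressed and cools when expanded: \<open>q * phi_minus \<gamma> q\<close> is the ratio of
  \<open>\<tau> * p\<close>, hence of the temperature. \<close>
lemma q_phi_minus_vs_1:
  assumes g: "\<gamma> > 1" and q: "0 < q"
  shows "1 < q \<Longrightarrow> 1 < q * phi_minus \<gamma> q" and "q \<le> 1 \<Longrightarrow> q * phi_minus \<gamma> q \<le> 1"
proof -
  have p: "q * phi_minus \<gamma> q > 0" using phi_minus_pos[OF g q] q by simp
  have imp: "sound_ratio \<gamma> (1 / q) = sqrt (1 / (q * phi_minus \<gamma> q))"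
    using q by (simp add: sound_ratio_def phi_plus_eq_inverse[OF g])
  show "1 < q * phi_minus \<gamma> q" if "1 < q"
    using sound_ratio_shock_less_1[OF g, of "1 / q"] that q p by (simp add: imp divide_less_eq)
  show "q * phi_minus \<gamma> q \<le> 1" if "q \<le> 1"
  proof -
    have "1 \<le> sound_ratio \<gamma> (1 / q)"
      using that q par_zeta_pos[OF g]
      by (simp add: sound_ratio_rarefaction[OF g] ge_one_powr_ge_zero)
    then show ?thesis using p by (simp add: imp le_divide_eq)
  qed
qed

text \<open> With \<open>x = 1 / f\<close> and \<open>y = B / f\<close>, the velocity equation compares \<open>sqrt c * \<psi>\<^sub>-(y)\<close> with \<open>\<psi>\<^sub>-(x)\<close>
  according to the sign of \<open>\<psi>\<^sub>-(B)\<close>.  By \<open>shock_jump_mono\<close> the resulting bound on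
  \<open>c\<close> becomes one by \<open>x \<phi>\<^sub>-(x) / (y \<phi>\<^sub>-(y))\<close>, and so \<open>C\<close> is bounded by \<open>1 / (B \<phi>\<^sub>-(B))\<close>, which lies on
  the same side of \<open>1\<close>. \<close>
lemma contact_out_vs_1:
  assumes g: "\<gamma> > 1" and pos: "0 < f" "0 < c" "0 < B" and f: "f < 1"
    and gap: "velocity_gap \<gamma> f c B = 0"
  shows "B > 1 \<Longrightarrow> contact_out \<gamma> f c B < 1" and "B < 1 \<Longrightarrow> contact_out \<gamma> f c B > 1"
proof -
  define x where "x = 1 / f"
  define y where "y = B * x"
  have "f < B" using root_vs_f(2)[OF g pos _ gap] f by simp
  then have x: "x > 1" and y: "y > 1"
    using f pos by (simp_all add: x_def y_def)
  have psi: "psi_minus \<gamma> x > 0" "psi_minus \<gamma> y > 0"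
    using x y by (simp_all add: psi_minus_pos_iff[OF g])
  have phi: "phi_minus \<gamma> x > 0" "phi_minus \<gamma> y > 0" "phi_minus \<gamma> B > 0"
    using x y pos by (simp_all add: phi_minus_pos[OF g])
  define X where "X = x * phi_minus \<gamma> x"
  define Y where "Y = y * phi_minus \<gamma> y"
  have XY: "X > 0" "Y > 0" using x y phi by (simp_all add: X_def Y_def)
  have out: "contact_out \<gamma> f c B = c * Y / (X * (B * phi_minus \<gamma> B))"
    using pos x by (simp add: contact_out_def X_def Y_def y_def x_def)
  have balance: "sound_ratio \<gamma> f * (sqrt c * psi_minus \<gamma> y - psi_minus \<gamma> x) = - psi_minus \<gamma> B"
    using gap by (simp add: velocity_gap_def x_def y_def algebra_simps)
  have sq: "(sqrt c * psi_minus \<gamma> y)\<^sup>2 = c * (psi_minus \<gamma> y)\<^sup>2"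
    using pos by (simp add: power_mult_distrib)
  show "contact_out \<gamma> f c B < 1" if B: "B > 1"
  proof -
    have "sound_ratio \<gamma> f * (sqrt c * psi_minus \<gamma> y - psi_minus \<gamma> x) < 0"
      using balance B psi_minus_pos_iff(1)[OF g, of B] by simp
    then have "sqrt c * psi_minus \<gamma> y < psi_minus \<gamma> x"
      using sound_ratio_pos[OF g pos(1)] by (simp add: mult_less_0_iff)
    then have "(sqrt c * psi_minus \<gamma> y)\<^sup>2 < (psi_minus \<gamma> x)\<^sup>2"
      using psi pos by (intro power_strict_mono) auto
    then have "c * (psi_minus \<gamma> y)\<^sup>2 * Y < (psi_minus \<gamma> x)\<^sup>2 * Y"
      using XY by (simp add: sq)
    also have "\<dots> \<le> (psi_minus \<gamma> y)\<^sup>2 * X"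
      unfolding X_def Y_def using x B by (intro shock_jump_mono[OF g]) (simp_all add: y_def)
    finally have "(psi_minus \<gamma> y)\<^sup>2 * (c * Y) < (psi_minus \<gamma> y)\<^sup>2 * X" by (simp add: mult_ac)
    then have "c * Y < X" using psi by simp
    also have "X < X * (B * phi_minus \<gamma> B)"
      using XY q_phi_minus_vs_1(1)[OF g pos(3) B] by simp
    finally show ?thesis using XY pos phi by (simp add: out divide_less_eq)
  qed
  show "contact_out \<gamma> f c B > 1" if B: "B < 1"
  proof -
    have "sound_ratio \<gamma> f * (sqrt c * psi_minus \<gamma> y - psi_minus \<gamma> x) > 0"
      using balance B pos psi_minus_pos_iff(2)[OF g, of B] by simp
    then have "psi_minus \<gamma> x < sqrt c * psi_minus \<gamma> y"
      using sound_ratio_pos[OF g pos(1)] by (simp add: zero_less_mult_iff)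
    then have "(psi_minus \<gamma> x)\<^sup>2 < (sqrt c * psi_minus \<gamma> y)\<^sup>2"
      using psi by (intro power_strict_mono) auto
    then have less: "(psi_minus \<gamma> x)\<^sup>2 * Y < c * (psi_minus \<gamma> y)\<^sup>2 * Y"
      using XY by (simp add: sq)
    have "(psi_minus \<gamma> y)\<^sup>2 * X \<le> (psi_minus \<gamma> x)\<^sup>2 * Y"
      unfolding X_def Y_def using x y B by (intro shock_jump_mono[OF g]) (simp_all add: y_def)
    also note less
    finally have "(psi_minus \<gamma> y)\<^sup>2 * X < (psi_minus \<gamma> y)\<^sup>2 * (c * Y)" by (simp add: mult_ac)
    then have "X < c * Y" using psi by simp
    moreover have "X * (B * phi_minus \<gamma> B) \<le> X * 1"
      using XY q_phi_minus_vs_1(2)[OF g pos(3)] B by (intro mult_left_mono) auto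
    ultimately have "X * (B * phi_minus \<gamma> B) < c * Y" by simp
    then show ?thesis using XY pos phi by (simp add: out less_divide_eq)
  qed
qed

text \<open> If the backward wave is a shock, the bound on \<open>C\<close> is the compression comparison
  \<open>phi_minus_supermult\<close>.  If it is a rarefaction, it leaves the entropy unchanged, and the outgoing
  forward shock is weaker than the incoming one, so it produces less entropy. \<close>
lemma contact_out_shock_vs_c:
  assumes g: "\<gamma> > 1" and pos: "0 < f" "0 < c" "0 < B" and f: "f < 1" and Bf: "f < B"
  shows "B > 1 \<Longrightarrow> contact_out \<gamma> f c B > c" and "B < 1 \<Longrightarrow> contact_out \<gamma> f c B < c"
proof -
  define x where "x = 1 / f"
  have x: "x > 1" "B * x > 1" using f pos Bf by (simp_all add: x_def)
  note E = entropy_factor_pos[OF g]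
  have out: "contact_out \<gamma> f c B = c * (phi_minus \<gamma> (B * x) / (phi_minus \<gamma> x * phi_minus \<gamma> B))"
    by (simp add: contact_out_def x_def)
  show "contact_out \<gamma> f c B > c" if "B > 1"
  proof -
    have "phi_minus \<gamma> x * phi_minus \<gamma> B < phi_minus \<gamma> (B * x)"
      using phi_minus_supermult[OF g x(1) that] by (simp add: mult.commute)
    then have "1 < phi_minus \<gamma> (B * x) / (phi_minus \<gamma> x * phi_minus \<gamma> B)"
      using phi_minus_pos[OF g] x pos by simp
    then have "c * 1 < c * (phi_minus \<gamma> (B * x) / (phi_minus \<gamma> x * phi_minus \<gamma> B))"
      using pos by (intro mult_strict_left_mono)
    then show ?thesis unfolding out by simp
  qed
  show "contact_out \<gamma> f c B < c" if "B < 1"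
  proof -
    have "B * x < x" using that x by simp
    then have "entropy_factor \<gamma> (B * x) < entropy_factor \<gamma> x"
      using entropy_factor_strict_mono[OF g, of "B * x" x] x by simp
    then have "c * entropy_factor \<gamma> (B * x) / entropy_factor \<gamma> x < c"
      using E[of x] x pos by (simp add: divide_less_eq)
    then show ?thesis
      using contact_out_entropy[OF g pos(1,3), of c] entropy_factor_rarefaction[OF pos(3), of \<gamma>] that
      by (simp add: x_def)
  qed
qed

lemma contact_out_rarefaction:
  assumes g: "\<gamma> > 1" and f: "1 < f" and B: "0 < B" "B < f"
  shows "contact_out \<gamma> f c B = c / entropy_factor \<gamma> B"
  using contact_out_entropy[OF g _ B(1), of f c] entropy_factor_rarefaction[of "B / f" \<gamma>]
    entropy_factor_rarefaction[of "1 / f" \<gamma>] f B by simp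

text \<open> Instead of following \<open>C\<close> as a function of \<open>f\<close>, prescribe \<open>B\<close> with \<open>c / T(B) = v\<close> and solve the velocity
  equation for \<open>f\<close>: as \<open>B < f\<close>, both forward waves are rarefactions and the equation is linear in
  \<open>f powr \<zeta>\<close>, with solution \<open>w\<close> below. \<close>
lemma contact_out_surj:
  assumes g: "\<gamma> > 1" and Ul: "Ul \<in> states" and c: "1 < c" and v: "0 < v" "v < c"
  obtains f where "f > 1" and "out_C \<gamma> Ul f c = v"
proof -
  note z = par_zeta_pos[OF g] and n = par_nu_pos[OF g]
  have "c / v > 1" using v by simp
  then obtain B where B: "B > 1" "entropy_factor \<gamma> B = c / v"
    using entropy_factor_surj[OF g] by blast
  define w where "w = (psi_minus \<gamma> B / par_nu \<gamma> + sqrt c * B powr par_zeta \<gamma> - 1) / (sqrt c - 1)"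
  have sc: "sqrt c - 1 > 0" using c by simp
  have "psi_minus \<gamma> B / par_nu \<gamma> > 0"
    using n B by (simp add: psi_minus_pos_iff[OF g])
  moreover have Bz: "B powr par_zeta \<gamma> > 1" using B z by (simp add: gr_one_powr)
  ultimately have "B powr par_zeta \<gamma> * (sqrt c - 1)
      < psi_minus \<gamma> B / par_nu \<gamma> + sqrt c * B powr par_zeta \<gamma> - 1"
    by (simp add: algebra_simps)
  then have w: "B powr par_zeta \<gamma> < w"
    using sc by (simp add: w_def pos_less_divide_eq)
  define f where "f = w powr (1 / par_zeta \<gamma>)"
  have fz: "f powr par_zeta \<gamma> = w"
    using w Bz z by (simp add: f_def powr_powr)
  have "B < f"
  proof (rule ccontr)
    assume "\<not> B < f"
    then have "f powr par_zeta \<gamma> \<le> B powr par_zeta \<gamma>"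
      using z by (intro powr_mono2) (auto simp: f_def)
    then show False using fz w by simp
  qed
  with B have f: "f > 1" by simp
  have low: "w * psi_minus \<gamma> (q / f) = par_nu \<gamma> * (q powr par_zeta \<gamma> - w)" if "0 < q" "q \<le> f" for q
    using that f w Bz by (simp add: psi_minus_def powr_divide fz field_simps)
  have "velocity_gap \<gamma> f c B
      = psi_minus \<gamma> B + sqrt c * (w * psi_minus \<gamma> (B / f)) - w * psi_minus \<gamma> (1 / f)"
    using f by (simp add: velocity_gap_def sound_ratio_rarefaction[OF g] fz)
  also have "\<dots> = psi_minus \<gamma> B + sqrt c * (par_nu \<gamma> * (B powr par_zeta \<gamma> - w))
      - par_nu \<gamma> * (1 - w)"
    using low[of B] low[of 1] B f \<open>B < f\<close> by simp
  also have "\<dots> = par_nu \<gamma> *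
      (psi_minus \<gamma> B / par_nu \<gamma> + sqrt c * B powr par_zeta \<gamma> - 1 - w * (sqrt c - 1))"
    using n by (simp add: algebra_simps)
  also have "\<dots> = 0" using sc by (simp add: w_def)
  finally have "velocity_gap \<gamma> f c B = 0" .
  then have "out_C \<gamma> Ul f c = contact_out \<gamma> f c B"
    using outgoing_eq(3)[OF g Ul, of f c B] f c B by simp
  also have "\<dots> = v"
    using contact_out_rarefaction[OF g f _ \<open>B < f\<close>] B v c by simp
  finally show ?thesis using that f by blast
qed

theorem theorem3p3:
  fixes \<gamma> :: real and Ul :: state
  assumes "\<gamma> > 1" and "Ul \<in> states"
  shows
    "(\<forall>f c. IIa f c \<or> IIb f c \<longrightarrow>
        (out_B \<gamma> Ul f c > 1 \<longleftrightarrow> c < 1) \<and> (out_B \<gamma> Ul f c < 1 \<longleftrightarrow> c > 1)) \<and>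
     (\<forall>f c. IIc f c \<or> IId f c \<longrightarrow>
        (out_B \<gamma> Ul f c > 1 \<longleftrightarrow> c > 1) \<and> (out_B \<gamma> Ul f c < 1 \<longleftrightarrow> c < 1)) \<and>
     (\<forall>f c. IIa f c \<or> IIb f c \<or> IIc f c \<or> IId f c \<longrightarrow>
        (out_F \<gamma> Ul f c > 1 \<longleftrightarrow> f > 1) \<and> (out_F \<gamma> Ul f c < 1 \<longleftrightarrow> f < 1)) \<and>
     (\<forall>f c. IIa f c \<longrightarrow> c < out_C \<gamma> Ul f c \<and> out_C \<gamma> Ul f c < 1) \<and>
     (\<forall>f c. IIb f c \<longrightarrow> 1 < out_C \<gamma> Ul f c \<and> out_C \<gamma> Ul f c < c) \<and>
     (\<forall>f c. IIc f c \<longrightarrow> out_C \<gamma> Ul f c = c \<and> c < 1) \<and>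
     (\<forall>f c. IId f c \<longrightarrow> out_C \<gamma> Ul f c < c) \<and>
     (\<forall>c>1. (\<exists>f>1. out_C \<gamma> Ul f c > 1) \<and> (\<exists>f>1. out_C \<gamma> Ul f c < 1)) \<and>
     (\<forall>c>1. {0<..<c} \<subseteq> (\<lambda>f. out_C \<gamma> Ul f c) ` {1<..}) \<and>
     (\<forall>f c. IIa f c \<or> IIb f c \<or> IId f c \<longrightarrow> \<not> forms_vacuum \<gamma> Ul f c) \<and>
     (\<forall>f c. IIc f c \<longrightarrow> (forms_vacuum \<gamma> Ul f c \<longleftrightarrow> f \<ge> f_star \<gamma> c))"
proof -
  note g = assms(1) and Ul = assms(2)
  have sol: "\<exists>B>0. velocity_gap \<gamma> f c B = 0 \<and> out_B \<gamma> Ul f c = B \<and>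
      out_C \<gamma> Ul f c = contact_out \<gamma> f c B \<and> out_F \<gamma> Ul f c = ereal (f / B)"
    if "0 < f" "0 < c" "f \<noteq> 1" "\<not> forms_vacuum \<gamma> Ul f c" for f c
    using velocity_gap_root_exists[OF g Ul that] outgoing_eq[OF g Ul that(1,2)] by metis
  have nv: "\<not> forms_vacuum \<gamma> Ul f c" if "IIa f c \<or> IIb f c \<or> IId f c" for f c
    using that no_vacuum_shock[OF g Ul, of f c] no_vacuum_rarefaction[OF g Ul, of f c]
    by (auto simp: IIa_def IIb_def IId_def)
  have pos: "0 < f \<and> 0 < c \<and> f \<noteq> 1" if "IIa f c \<or> IIb f c \<or> IIc f c \<or> IId f c" for f c
    using that by (auto simp: IIa_def IIb_def IIc_def IId_def)
  have ab: "(out_B \<gamma> Ul f c > 1 \<longleftrightarrow> c < 1) \<and> (out_B \<gamma> Ul f c < 1 \<longleftrightarrow> c > 1)"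
    if t: "IIa f c \<or> IIb f c" for f c
  proof -
    have p: "0 < f" "0 < c" "f \<noteq> 1" "f < 1"
      using t by (auto simp: IIa_def IIb_def)
    from sol[OF p(1-3)] nv t obtain B where "B > 0" "velocity_gap \<gamma> f c B = 0" "out_B \<gamma> Ul f c = B"
      by blast
    then show ?thesis using root_vs_1[OF g p(1,2) _ p(3)] p(4) by simp
  qed
  have cd: "(out_B \<gamma> Ul f c > 1 \<longleftrightarrow> c > 1) \<and> (out_B \<gamma> Ul f c < 1 \<longleftrightarrow> c < 1)"
    if t: "IIc f c \<or> IId f c" for f c
  proof (cases "forms_vacuum \<gamma> Ul f c")
    case True
    with nv t have "IIc f c" by blast
    then show ?thesis using outgoing_vacuum(1)[OF g Ul _ _ True] by (auto simp: IIc_def)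
  next
    case False
    have p: "0 < f" "0 < c" "f \<noteq> 1" "\<not> f < 1"
      using t by (auto simp: IIc_def IId_def)
    from sol[OF p(1-3) False] obtain B where "B > 0" "velocity_gap \<gamma> f c B = 0" "out_B \<gamma> Ul f c = B"
      by blast
    then show ?thesis using root_vs_1[OF g p(1,2) _ p(3)] p(4) by simp
  qed
  have F: "(out_F \<gamma> Ul f c > 1 \<longleftrightarrow> f > 1) \<and> (out_F \<gamma> Ul f c < 1 \<longleftrightarrow> f < 1)"
    if t: "IIa f c \<or> IIb f c \<or> IIc f c \<or> IId f c" for f c
  proof (cases "forms_vacuum \<gamma> Ul f c")
    case True
    with nv t have "IIc f c" by blast
    then show ?thesis using outgoing_vacuum(3)[OF g Ul _ _ True] by (auto simp: IIc_def)
  next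
    case False
    have p: "0 < f" "0 < c" "f \<noteq> 1" using pos[OF t] by auto
    from sol[OF p False] obtain B where B: "B > 0" "velocity_gap \<gamma> f c B = 0"
      and F: "out_F \<gamma> Ul f c = ereal (f / B)"
      by blast
    have "(out_F \<gamma> Ul f c > 1 \<longleftrightarrow> B < f) \<and> (out_F \<gamma> Ul f c < 1 \<longleftrightarrow> f < B)"
      using B(1) unfolding F one_ereal_def by simp
    then show ?thesis using root_vs_f[OF g p(1,2) B(1) p(3) B(2)] by simp
  qed
  have Ca: "c < out_C \<gamma> Ul f c \<and> out_C \<gamma> Ul f c < 1" if t: "IIa f c" for f c
  proof -
    have p: "0 < f" "0 < c" "f \<noteq> 1" "f < 1" "c < 1" using t by (auto simp: IIa_def)
    from sol[OF p(1-3)] nv t obtain B where B: "B > 0" "velocity_gap \<gamma> f c B = 0"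
      and C: "out_C \<gamma> Ul f c = contact_out \<gamma> f c B" by blast
    show ?thesis
      using root_vs_1[OF g p(1,2) B(1) p(3) B(2)] root_vs_f[OF g p(1,2) B(1) p(3) B(2)] p
        contact_out_vs_1(1)[OF g p(1,2) B(1) p(4) B(2)] contact_out_shock_vs_c(1)[OF g p(1,2) B(1) p(4)]
      by (simp add: C)
  qed
  have Cb: "1 < out_C \<gamma> Ul f c \<and> out_C \<gamma> Ul f c < c" if t: "IIb f c" for f c
  proof -
    have p: "0 < f" "0 < c" "f \<noteq> 1" "f < 1" "c > 1" using t by (auto simp: IIb_def)
    from sol[OF p(1-3)] nv t obtain B where B: "B > 0" "velocity_gap \<gamma> f c B = 0"
      and C: "out_C \<gamma> Ul f c = contact_out \<gamma> f c B" by blast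
    show ?thesis
      using root_vs_1[OF g p(1,2) B(1) p(3) B(2)] root_vs_f[OF g p(1,2) B(1) p(3) B(2)] p
        contact_out_vs_1(2)[OF g p(1,2) B(1) p(4) B(2)] contact_out_shock_vs_c(2)[OF g p(1,2) B(1) p(4)]
      by (simp add: C)
  qed
  have Cc: "out_C \<gamma> Ul f c = c \<and> c < 1" if t: "IIc f c" for f c
  proof -
    have p: "0 < f" "0 < c" "f \<noteq> 1" "f > 1" "c < 1" using t by (auto simp: IIc_def)
    show ?thesis
    proof (cases "forms_vacuum \<gamma> Ul f c")
      case True
      then show ?thesis using outgoing_vacuum(2)[OF g Ul p(4,2)] p by simp
    next
      case False
      from sol[OF p(1-3) False] obtain B where B: "B > 0" "velocity_gap \<gamma> f c B = 0"
        and C: "out_C \<gamma> Ul f c = contact_out \<gamma> f c B" by blast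
      show ?thesis
        using root_vs_1(2)[OF g p(1,2) B(1) p(3) B(2)] root_vs_f[OF g p(1,2) B(1) p(3) B(2)] p
          contact_out_rarefaction[OF g p(4) B(1)] entropy_factor_rarefaction[OF B(1), of \<gamma>]
        by (simp add: C)
    qed
  qed
  have Cd: "out_C \<gamma> Ul f c < c" if t: "IId f c" for f c
  proof -
    have p: "0 < f" "0 < c" "f \<noteq> 1" "f > 1" "c > 1" using t by (auto simp: IId_def)
    from sol[OF p(1-3)] nv t obtain B where B: "B > 0" "velocity_gap \<gamma> f c B = 0"
      and C: "out_C \<gamma> Ul f c = contact_out \<gamma> f c B" by blast
    have "B > 1" "B < f"
      using root_vs_1(1)[OF g p(1,2) B(1) p(3) B(2)] root_vs_f(1)[OF g p(1,2) B(1) p(3) B(2)] p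
      by simp_all
    then show ?thesis
      using contact_out_rarefaction[OF g p(4) B(1)] entropy_factor_shock[OF g, of B] p
      by (simp add: C divide_less_eq)
  qed
  have surj: "{0<..<c} \<subseteq> (\<lambda>f. out_C \<gamma> Ul f c) ` {1<..}" if c: "c > 1" for c
  proof
    fix v assume "v \<in> {0<..<c}"
    then obtain f where "f > 1" "out_C \<gamma> Ul f c = v"
      using contact_out_surj[OF g Ul c, of v] by auto
    then show "v \<in> (\<lambda>f. out_C \<gamma> Ul f c) ` {1<..}" by auto
  qed
  have both: "(\<exists>f>1. out_C \<gamma> Ul f c > 1) \<and> (\<exists>f>1. out_C \<gamma> Ul f c < 1)" if c: "c > 1" for c
  proof -
    have "(1 + c) / 2 \<in> {0<..<c}" "1 / 2 \<in> {0<..<c}" using c by auto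
    then obtain f1 f2 where "f1 > 1" "out_C \<gamma> Ul f1 c = (1 + c) / 2"
      "f2 > 1" "out_C \<gamma> Ul f2 c = 1 / 2"
      using subsetD[OF surj[OF c]] by (metis (no_types, lifting) greaterThan_iff imageE)
    moreover have "(1 + c) / 2 > 1" "1 / 2 < (1::real)" using c by auto
    ultimately show ?thesis by metis
  qed
  have vac: "forms_vacuum \<gamma> Ul f c \<longleftrightarrow> f \<ge> f_star \<gamma> c" if "IIc f c" for f c
    using vacuum_iff_f_star[OF g Ul] that by (auto simp: IIc_def)
  show ?thesis
    using ab cd F Ca Cb Cc Cd both surj nv vac by (intro conjI allI impI) blast+
qed

end
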